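(* Let $F$ be a separable, infinite dimensional, complex Fréchet space with a continuous norm. Let $G$ be a (non-empty) open connected domain in $\mathbb{C}$. Then there exists a Fréchet space $E \subset H(G)$ of holomorphic functions on $G$ such that $F$ is isomorphic to $E$ and the polynomials are dense in $E$.
   Context: $H(G)$ denotes the Fréchet space of holomorphic functions on $G$, endowed with the topology of uniform convergence on compact subsets of $G$. A Fréchet space $E$ of holomorphic functions on the domain $G$ is a complex Fréchet space that is a (linear) subspace of $H(G)$, with its own Fréchet topology, such that the inclusion map $E \subset H(G)$ is continuous and $E$ contains the polynomials (i.e. the restrictions to $G$ of all complex polynomials in $z$). A Fréchet space has a continuous norm if there is a norm $p$ on it that is continuous for its Fréchet space topology (the topology need not be given by $p$). Isomorphic means that there is a linear bijection that is a homeomorphism. Density of the polynomials in $E$ is with respect to the Fréchet topology of $E$. *)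

theory Defs
  imports
    "HOL-Complex_Analysis.Complex_Analysis"
    "HOL-Computational_Algebra.Polynomial"
    "HOL-Library.Function_Algebras"
begin

text \<open>
  A complex vector space is given by a scalar multiplication
  \<open>s :: complex \<Rightarrow> 'a \<Rightarrow> 'a\<close> making the whole type \<open>'a\<close> a vector space, together with a linear
  subspace \<open>V\<close>, the carrier; its topology is a value of type \<open>'a topology\<close> with \<open>topspace\<close> equal
  to \<open>V\<close>. Explicit carriers allow one notion of Frechet space to cover both an abstract space and
  a space of functions on a domain.
\<close>

definition seminorm_on :: "(complex \<Rightarrow> 'a::ab_group_add \<Rightarrow> 'a) \<Rightarrow> 'a set \<Rightarrow> ('a \<Rightarrow> real) \<Rightarrow> bool"
  where "seminorm_on s V p \<longleftrightarrow>
    (\<forall>x\<in>V. 0 \<le> p x) \<and>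
    (\<forall>c. \<forall>x\<in>V. p (s c x) = cmod c * p x) \<and>
    (\<forall>x\<in>V. \<forall>y\<in>V. p (x + y) \<le> p x + p y)"

definition norm_on :: "(complex \<Rightarrow> 'a::ab_group_add \<Rightarrow> 'a) \<Rightarrow> 'a set \<Rightarrow> ('a \<Rightarrow> real) \<Rightarrow> bool"
  where "norm_on s V p \<longleftrightarrow> seminorm_on s V p \<and> (\<forall>x\<in>V. p x = 0 \<longrightarrow> x = 0)"

text \<open>The locally convex topology on \<open>V\<close> generated by a family \<open>P\<close> of seminorms.\<close>

definition seminorm_topology :: "'a::ab_group_add set \<Rightarrow> ('a \<Rightarrow> real) set \<Rightarrow> 'a topology"
  where "seminorm_topology V P = topology (\<lambda>U. U \<subseteq> V \<and>
    (\<forall>x\<in>U. \<exists>Q \<epsilon>. finite Q \<and> Q \<subseteq> P \<and> 0 < \<epsilon> \<and> {y\<in>V. \<forall>p\<in>Q. p (y - x) < \<epsilon>} \<subseteq> U))"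

lemma openin_seminorm_topology:
  "openin (seminorm_topology V P) U \<longleftrightarrow> U \<subseteq> V \<and>
    (\<forall>x\<in>U. \<exists>Q \<epsilon>. finite Q \<and> Q \<subseteq> P \<and> 0 < \<epsilon> \<and> {y\<in>V. \<forall>p\<in>Q. p (y - x) < \<epsilon>} \<subseteq> U)"
proof -
  let ?nb = "\<lambda>U x. \<exists>Q \<epsilon>. finite Q \<and> Q \<subseteq> P \<and> (0::real) < \<epsilon> \<and> {y\<in>V. \<forall>p\<in>Q. p (y - x) < \<epsilon>} \<subseteq> U"
  have int: "?nb (S \<inter> T) x" if S: "?nb S x" and T: "?nb T x" for S T x
  proof -
    obtain Q1 e1 where 1: "finite Q1" "Q1 \<subseteq> P" "(0::real) < e1"
        "{y\<in>V. \<forall>p\<in>Q1. p (y - x) < e1} \<subseteq> S"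
      using S by blast
    obtain Q2 e2 where 2: "finite Q2" "Q2 \<subseteq> P" "(0::real) < e2"
        "{y\<in>V. \<forall>p\<in>Q2. p (y - x) < e2} \<subseteq> T"
      using T by blast
    have "{y\<in>V. \<forall>p\<in>Q1 \<union> Q2. p (y - x) < min e1 e2} \<subseteq> S \<inter> T"
      using 1(4) 2(4) by auto
    then show ?thesis
      using 1 2 by (intro exI[of _ "Q1 \<union> Q2"] exI[of _ "min e1 e2"]) auto
  qed
  have un: "?nb (\<Union>K) x" if S: "S \<in> K" and x: "?nb S x" for K S x
  proof -
    obtain Q e where Q: "finite Q" "Q \<subseteq> P" "(0::real) < e" "{y\<in>V. \<forall>p\<in>Q. p (y - x) < e} \<subseteq> S"
      using x by blast
    moreover have "{y\<in>V. \<forall>p\<in>Q. p (y - x) < e} \<subseteq> \<Union>K"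
      using Q(4) Union_upper[OF S] by (rule order_trans)
    ultimately show ?thesis by (intro exI[of _ Q] exI[of _ e]) simp
  qed
  have "istopology (\<lambda>U. U \<subseteq> V \<and> (\<forall>x\<in>U. ?nb U x))"
    unfolding istopology_def
  proof (intro conjI allI impI)
    fix S T
    assume S: "S \<subseteq> V \<and> (\<forall>x\<in>S. ?nb S x)" and T: "T \<subseteq> V \<and> (\<forall>x\<in>T. ?nb T x)"
    show "S \<inter> T \<subseteq> V" using conjunct1[OF S] by (rule le_infI1)
    show "\<forall>x\<in>S \<inter> T. ?nb (S \<inter> T) x"
    proof
      fix x assume "x \<in> S \<inter> T"
      then show "?nb (S \<inter> T) x"
        by (intro int bspec[OF conjunct2[OF S]] bspec[OF conjunct2[OF T]]) simp_all
    qed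
  next
    fix K
    assume K: "\<forall>S\<in>K. S \<subseteq> V \<and> (\<forall>x\<in>S. ?nb S x)"
    then show "\<Union>K \<subseteq> V" by (simp add: Union_least)
    show "\<forall>x\<in>\<Union>K. ?nb (\<Union>K) x"
    proof
      fix x assume "x \<in> \<Union>K"
      then obtain S where "S \<in> K" "x \<in> S" by (rule UnionE)
      then show "?nb (\<Union>K) x"
        by (intro un[of S] bspec[OF conjunct2[OF bspec[OF K]]]) simp_all
    qed
  qed
  then show ?thesis
    by (simp add: seminorm_topology_def)
qed

lemma topspace_seminorm_topology [simp]: "topspace (seminorm_topology V P) = V"
proof (rule antisym)
  show "topspace (seminorm_topology V P) \<subseteq> V"
    using openin_topspace[of "seminorm_topology V P"]
    unfolding openin_seminorm_topology by (rule conjunct1)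
  have "openin (seminorm_topology V P) V"
    unfolding openin_seminorm_topology
    by (intro conjI ballI exI[of _ "{}"] exI[of _ 1]) simp_all
  then show "V \<subseteq> topspace (seminorm_topology V P)"
    by (rule openin_subset)
qed

text \<open>
  A complex Frechet space: a Hausdorff locally convex space whose topology is generated by
  countably many seminorms and which is complete. The topology being metrizable, sequential
  completeness is completeness.
\<close>

definition frechet_space ::
    "(complex \<Rightarrow> 'a::ab_group_add \<Rightarrow> 'a) \<Rightarrow> 'a set \<Rightarrow> 'a topology \<Rightarrow> bool"
  where "frechet_space s V T \<longleftrightarrow> vector_space s \<and> module.subspace s V \<and>
    (\<exists>p :: nat \<Rightarrow> 'a \<Rightarrow> real.
      (\<forall>n. seminorm_on s V (p n)) \<and>
      (\<forall>x\<in>V. (\<forall>n. p n x = 0) \<longrightarrow> x = 0) \<and>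
      T = seminorm_topology V (range p) \<and>
      (\<forall>X :: nat \<Rightarrow> 'a. range X \<subseteq> V \<longrightarrow>
        (\<forall>n. \<forall>\<epsilon>>0. \<exists>N. \<forall>i\<ge>N. \<forall>j\<ge>N. p n (X i - X j) < \<epsilon>) \<longrightarrow>
        (\<exists>x\<in>V. limitin T X x sequentially)))"

definition has_continuous_norm ::
    "(complex \<Rightarrow> 'a::ab_group_add \<Rightarrow> 'a) \<Rightarrow> 'a set \<Rightarrow> 'a topology \<Rightarrow> bool"
  where "has_continuous_norm s V T \<longleftrightarrow>
    (\<exists>p. norm_on s V p \<and> continuous_map T euclideanreal p)"

definition infinite_dimensional :: "(complex \<Rightarrow> 'a::ab_group_add \<Rightarrow> 'a) \<Rightarrow> 'a set \<Rightarrow> bool"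
  where "infinite_dimensional s V \<longleftrightarrow>
    \<not> (\<exists>B. finite B \<and> B \<subseteq> V \<and> module.span s B = V)"

definition isomorphic_tvs ::
    "(complex \<Rightarrow> 'a::ab_group_add \<Rightarrow> 'a) \<Rightarrow> 'a set \<Rightarrow> 'a topology \<Rightarrow>
     (complex \<Rightarrow> 'b::ab_group_add \<Rightarrow> 'b) \<Rightarrow> 'b set \<Rightarrow> 'b topology \<Rightarrow> bool"
  where "isomorphic_tvs s V T s' V' T' \<longleftrightarrow>
    (\<exists>f. bij_betw f V V' \<and>
      (\<forall>x\<in>V. \<forall>y\<in>V. f (x + y) = f x + f y) \<and>
      (\<forall>c. \<forall>x\<in>V. f (s c x) = s' c (f x)) \<and>
      homeomorphic_map T T' f)"

definition fun_scale :: "complex \<Rightarrow> (complex \<Rightarrow> complex) \<Rightarrow> complex \<Rightarrow> complex"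
  where "fun_scale c f = (\<lambda>z. c * f z)"

text \<open>
  A function on \<open>G\<close> is represented by its extension by 0, so that equality of the representing
  functions is equality on \<open>G\<close>.
\<close>

definition restrict0 :: "complex set \<Rightarrow> (complex \<Rightarrow> complex) \<Rightarrow> complex \<Rightarrow> complex"
  where "restrict0 G f = (\<lambda>z. if z \<in> G then f z else 0)"

definition hol_space :: "complex set \<Rightarrow> (complex \<Rightarrow> complex) set"
  where "hol_space G = {f. f holomorphic_on G \<and> (\<forall>z. z \<notin> G \<longrightarrow> f z = 0)}"

text \<open>
  The topology of uniform convergence on compact subsets of \<open>G\<close>. The empty compact set is left out
  only because \<open>Sup {}\<close> has no useful value in the reals.
\<close>

definition hol_topology :: "complex set \<Rightarrow> (complex \<Rightarrow> complex) topology"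
  where "hol_topology G = seminorm_topology (hol_space G)
    {(\<lambda>f. SUP z\<in>K. cmod (f z)) | K. compact K \<and> K \<noteq> {} \<and> K \<subseteq> G}"

definition polynomials_on :: "complex set \<Rightarrow> (complex \<Rightarrow> complex) set"
  where "polynomials_on G = range (\<lambda>q :: complex poly. restrict0 G (poly q))"

definition frechet_space_of_holomorphic_functions ::
    "complex set \<Rightarrow> (complex \<Rightarrow> complex) set \<Rightarrow> (complex \<Rightarrow> complex) topology \<Rightarrow> bool"
  where "frechet_space_of_holomorphic_functions G E T \<longleftrightarrow>
    frechet_space fun_scale E T \<and>
    E \<subseteq> hol_space G \<and>
    continuous_map T (hol_topology G) (\<lambda>f. f) \<and>
    polynomials_on G \<subseteq> E"

end

theory Submission
  imports Defs
begin

text \<open>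
  Let \<open>\<nu>\<close> be a continuous norm on \<open>F\<close> and \<open>(X\<^sub>k)\<close> a dense sequence. By Hahn-Banach there are
  countably many \<open>\<nu>\<close>-bounded functionals \<open>f\<^sub>k\<close> separating the points of \<open>F\<close>. Markushevich's
  biorthogonalisation gives a biorthogonal sequence \<open>(e\<^sub>n, g\<^sub>n)\<close> such that the spans of the \<open>e\<^sub>n\<close>
  and of the \<open>g\<^sub>n\<close> contain all \<open>X\<^sub>k\<close> and all \<open>f\<^sub>k\<close>, respectively, so
  that the span of the \<open>e\<^sub>n\<close> is dense and the \<open>g\<^sub>n\<close> separate points. If \<open>a\<^sub>n > 0\<close> decreases fast
  enough, \<open>x \<mapsto> \<Sum>\<^sub>n a\<^sub>n g\<^sub>n(x) z\<^sup>n\<close> is a continuous injection of \<open>F\<close> into the entire functions; it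
  takes the span of the \<open>e\<^sub>n\<close> onto the polynomials. Its image, with the topology of \<open>F\<close>, is \<open>E\<close>.
\<close>

text \<open>The functionals and the embedding are built in the normed space
  \<open>(V, \<nu>)\<close> alone. The Frechet topology of the space enters only afterwards, through
  the continuity of \<open>\<nu>\<close>.\<close>

locale normed_carrier = vector_space s
  for s :: "complex \<Rightarrow> 'a::ab_group_add \<Rightarrow> 'a" +
  fixes V :: "'a set" and \<nu> :: "'a \<Rightarrow> real"
  assumes subspace_V: "subspace V"
    and norm_\<nu>: "norm_on s V \<nu>"
begin

lemma V_zero [simp]: "0 \<in> V"
  and V_add [intro, simp]: "x \<in> V \<Longrightarrow> y \<in> V \<Longrightarrow> x + y \<in> V"
  and V_scale [intro, simp]: "x \<in> V \<Longrightarrow> s c x \<in> V"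
  and V_diff [intro, simp]: "x \<in> V \<Longrightarrow> y \<in> V \<Longrightarrow> x - y \<in> V"
  and V_minus [intro, simp]: "x \<in> V \<Longrightarrow> - x \<in> V"
  and V_sum [intro]: "(\<And>i. i \<in> I \<Longrightarrow> h i \<in> V) \<Longrightarrow> sum h I \<in> V"
  using subspace_V
  by (auto intro: subspace_0 subspace_add subspace_scale subspace_diff subspace_neg subspace_sum)

lemma \<nu>_nonneg: "x \<in> V \<Longrightarrow> 0 \<le> \<nu> x"
  and \<nu>_scale: "x \<in> V \<Longrightarrow> \<nu> (s c x) = cmod c * \<nu> x"
  and \<nu>_add: "x \<in> V \<Longrightarrow> y \<in> V \<Longrightarrow> \<nu> (x + y) \<le> \<nu> x + \<nu> y"
  and \<nu>_eq_0: "x \<in> V \<Longrightarrow> \<nu> x = 0 \<Longrightarrow> x = 0"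
  using norm_\<nu> by (auto simp: norm_on_def seminorm_on_def)

lemma \<nu>_minus: "x \<in> V \<Longrightarrow> \<nu> (- x) = \<nu> x"
  using \<nu>_scale[of x "-1"] by (simp add: scale_minus_left)

lemma \<nu>_minus_commute: "x \<in> V \<Longrightarrow> y \<in> V \<Longrightarrow> \<nu> (x - y) = \<nu> (y - x)"
  using \<nu>_minus[of "x - y"] by simp

subsection \<open>Sublinear functionals and Hahn-Banach\<close>

text \<open>Homogeneity is demanded as an inequality, a form that passes to infima; rescaling by
  \<open>1 / t\<close> turns it into an equality. The case \<open>t = 0\<close> supplies
  \<open>q 0 \<le> 0\<close>.\<close>

definition sublinear :: "('a \<Rightarrow> real) \<Rightarrow> bool"
  where "sublinear q \<longleftrightarrow> (\<forall>x\<in>V. \<forall>y\<in>V. q (x + y) \<le> q x + q y) \<and>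
    (\<forall>t::real\<ge>0. \<forall>x\<in>V. q (s (of_real t) x) \<le> t * q x)"

lemma sublinear_add: "sublinear q \<Longrightarrow> x \<in> V \<Longrightarrow> y \<in> V \<Longrightarrow> q (x + y) \<le> q x + q y"
  by (auto simp: sublinear_def)

lemma sublinear_0:
  assumes "sublinear q" shows "q 0 = 0"
proof -
  have "q (s (of_real 0) 0) \<le> 0 * q 0"
    using assms unfolding sublinear_def by (metis V_zero order_refl)
  moreover have "q (0 + 0) \<le> q 0 + q 0"
    using assms by (intro sublinear_add) auto
  ultimately show ?thesis by simp
qed

lemma sublinear_scale:
  assumes "sublinear q" "t \<ge> 0" "x \<in> V"
  shows "q (s (of_real t) x) = t * q x"
proof (cases "t = 0")
  case True
  then show ?thesis using sublinear_0[OF assms(1)] by simp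
next
  case False
  have "q x = q (s (of_real (1/t)) (s (of_real t) x))"
    using False by simp
  also have "\<dots> \<le> (1/t) * q (s (of_real t) x)"
    using assms unfolding sublinear_def by (meson V_scale divide_nonneg_nonneg zero_le_one)
  finally have "t * q x \<le> q (s (of_real t) x)"
    using False assms(2) by (simp add: field_simps)
  then show ?thesis
    using assms unfolding sublinear_def by (meson order_antisym)
qed

lemma sublinear_minus_le:
  assumes "sublinear q" "x \<in> V"
  shows "- q (- x) \<le> q x"
  using sublinear_add[OF assms(1,2), of "- x"] sublinear_0[OF assms(1)] assms(2) by simp

text \<open>
  \<open>tilt q y\<close> is sublinear, lies below \<open>q\<close>, and satisfies \<open>tilt q y (- y) \<le> - q y\<close>. Hence a minimal
  sublinear functional is fixed by every tilt, which makes it additive; and a linear functional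
  below \<open>tilt \<nu> y\<close> attains the norm at \<open>y\<close>. This yields Hahn-Banach without extending from
  subspaces.
\<close>

definition tilt :: "('a \<Rightarrow> real) \<Rightarrow> 'a \<Rightarrow> 'a \<Rightarrow> real"
  where "tilt q y x = (INF t\<in>{0..}. q (x + s (of_real t) y) - t * q y)"

text \<open>The bound \<open>- q (- x)\<close> is uniform in \<open>t\<close>; it makes the real
  infimum defining \<open>tilt\<close> meaningful.\<close>

lemma tilt_bdd:
  assumes "sublinear q" "x \<in> V" "y \<in> V"
  shows "bdd_below ((\<lambda>t. q (x + s (of_real t) y) - t * q y) ` {0..})"
proof (rule bdd_belowI2)
  fix t :: real assume "t \<in> {0..}"
  then have "t * q y = q (s (of_real t) y)"
    using assms by (simp add: sublinear_scale)
  also have "\<dots> = q ((x + s (of_real t) y) + - x)"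
    by simp
  also have "\<dots> \<le> q (x + s (of_real t) y) + q (- x)"
    using assms by (intro sublinear_add) auto
  finally show "- q (- x) \<le> q (x + s (of_real t) y) - t * q y" by simp
qed

lemma tilt_le:
  assumes "sublinear q" "x \<in> V" "y \<in> V" "t \<ge> 0"
  shows "tilt q y x \<le> q (x + s (of_real t) y) - t * q y"
  unfolding tilt_def using assms by (intro cINF_lower tilt_bdd) auto

lemma tilt_greatest:
  assumes "\<And>t. t \<ge> 0 \<Longrightarrow> m \<le> q (x + s (of_real t) y) - t * q y"
  shows "m \<le> tilt q y x"
  unfolding tilt_def using assms by (intro cINF_greatest) auto

lemma tilt_le_self: "sublinear q \<Longrightarrow> x \<in> V \<Longrightarrow> y \<in> V \<Longrightarrow> tilt q y x \<le> q x"
  using tilt_le[of q x y 0] by simp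

lemma sublinear_tilt:
  assumes q: "sublinear q" and y: "y \<in> V"
  shows "sublinear (tilt q y)"
  unfolding sublinear_def
proof (intro conjI ballI allI impI)
  fix x x' assume x: "x \<in> V" "x' \<in> V"
  \<comment> \<open>The two infima are taken one after the other: with \<open>t\<close> fixed, the
    parameter \<open>t + t'\<close> gives the estimate for every \<open>t'\<close>.\<close>
  have "tilt q y (x + x') - (q (x + s (of_real t) y) - t * q y) \<le> tilt q y x'" if t: "t \<ge> 0" for t
  proof (rule tilt_greatest)
    fix t' :: real assume t': "t' \<ge> 0"
    have "tilt q y (x + x') \<le> q ((x + x') + s (of_real (t + t')) y) - (t + t') * q y"
      using t t' q x y by (intro tilt_le) auto
    also have "(x + x') + s (of_real (t + t')) y = (x + s (of_real t) y) + (x' + s (of_real t') y)"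
      by (simp add: scale_left_distrib)
    also have "q \<dots> \<le> q (x + s (of_real t) y) + q (x' + s (of_real t') y)"
      using q x y by (intro sublinear_add) auto
    finally show "tilt q y (x + x') - (q (x + s (of_real t) y) - t * q y)
        \<le> q (x' + s (of_real t') y) - t' * q y"
      by (simp add: algebra_simps)
  qed
  then have "tilt q y (x + x') - tilt q y x' \<le> tilt q y x"
    by (intro tilt_greatest) (simp add: algebra_simps)
  then show "tilt q y (x + x') \<le> tilt q y x + tilt q y x'" by simp
next
  fix c :: real and x assume c: "0 \<le> c" and x: "x \<in> V"
  show "tilt q y (s (of_real c) x) \<le> c * tilt q y x"
  proof (cases "c = 0")
    case True
    then show ?thesis using tilt_le_self[OF q V_zero y] sublinear_0[OF q] by simp
  next
    case False
    have "tilt q y (s (of_real c) x) / c \<le> tilt q y x"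
    proof (rule tilt_greatest)
      fix t :: real assume t: "t \<ge> 0"
      \<comment> \<open>The parameter \<open>c * t\<close> becomes \<open>t\<close> once
        \<open>c\<close> is factored out.\<close>
      have "tilt q y (s (of_real c) x) \<le> q (s (of_real c) x + s (of_real (c * t)) y) - c * t * q y"
        using t c q x y by (intro tilt_le) auto
      also have "s (of_real c) x + s (of_real (c * t)) y = s (of_real c) (x + s (of_real t) y)"
        by (simp add: scale_right_distrib)
      also have "q \<dots> = c * q (x + s (of_real t) y)"
        using q c x y by (intro sublinear_scale) auto
      finally show "tilt q y (s (of_real c) x) / c \<le> q (x + s (of_real t) y) - t * q y"
        using False c by (simp add: field_simps)
    qed
    then show ?thesis using False c by (simp add: field_simps)
  qed
qed

text \<open>Infima of sublinear functionals need not be subadditive. In a chain they are, since the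
  smaller of \<open>q\<close> and \<open>q'\<close> lies below both at both points.\<close>

lemma sublinear_Inf_chain:
  assumes "C \<noteq> {}" and subl: "\<And>q. q \<in> C \<Longrightarrow> sublinear q"
    and bd: "\<And>x. x \<in> V \<Longrightarrow> bdd_below ((\<lambda>q. q x) ` C)"
    and chain: "\<And>q q'. q \<in> C \<Longrightarrow> q' \<in> C \<Longrightarrow> (\<forall>x\<in>V. q x \<le> q' x) \<or> (\<forall>x\<in>V. q' x \<le> q x)"
  shows "sublinear (\<lambda>x. INF q\<in>C. q x)"
  unfolding sublinear_def
proof (intro conjI ballI allI impI)
  fix x y assume x: "x \<in> V" and y: "y \<in> V"
  let ?I = "\<lambda>x. INF q\<in>C. q x"
  have *: "?I (x + y) \<le> q x + q' y" if q: "q \<in> C" "q' \<in> C" for q q'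
  proof -
    obtain q0 where q0: "q0 \<in> C" "q0 x \<le> q x" "q0 y \<le> q' y"
      using chain[OF q] x y q by auto
    have "?I (x + y) \<le> q0 (x + y)"
      using bd[of "x + y"] x y q0 by (intro cINF_lower) auto
    then show ?thesis
      using sublinear_add[OF subl[OF q0(1)] x y] q0 by linarith
  qed
  have "?I (x + y) - q x \<le> ?I y" if "q \<in> C" for q
    using *[OF that] assms(1) by (intro cINF_greatest) (auto simp: algebra_simps)
  then have "?I (x + y) - ?I y \<le> ?I x"
    using assms(1) by (intro cINF_greatest) (auto simp: algebra_simps)
  then show "?I (x + y) \<le> ?I x + ?I y" by simp
next
  fix t :: real and x assume t: "0 \<le> t" and x: "x \<in> V"
  let ?I = "\<lambda>x. INF q\<in>C. q x"
  have *: "?I (s (of_real t) x) \<le> t * q x" if "q \<in> C" for q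
    using cINF_lower[OF bd[of "s (of_real t) x"] that] x sublinear_scale[OF subl[OF that] t x]
    by auto
  show "?I (s (of_real t) x) \<le> t * ?I x"
  proof (cases "t = 0")
    case True
    then show ?thesis using * assms(1) by fastforce
  next
    case False
    have "?I (s (of_real t) x) / t \<le> ?I x"
      using * assms(1) t False by (intro cINF_greatest) (auto simp: field_simps)
    then show ?thesis using t False by (simp add: field_simps)
  qed
qed

text \<open>Zorn's lemma for the sublinear functionals below \<open>p\<close>. A nonempty chain is
  bounded below pointwise by \<open>- p (- x)\<close>, so its pointwise infimum is again such a
  functional.\<close>

lemma minimal_sublinear:
  assumes p: "sublinear p"
  obtains q where "sublinear q" "\<And>x. x \<in> V \<Longrightarrow> q x \<le> p x"
    "\<And>q' x. sublinear q' \<Longrightarrow> \<forall>x\<in>V. q' x \<le> q x \<Longrightarrow> x \<in> V \<Longrightarrow> q' x = q x"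
proof -
  \<comment> \<open>Functionals are compared on \<open>V\<close> only; the value 0 elsewhere makes
    the order antisymmetric on functions.\<close>
  define cut where "cut q = (\<lambda>x. if x \<in> V then q x else 0)" for q :: "'a \<Rightarrow> real"
  have cut: "sublinear (cut q) \<longleftrightarrow> sublinear q" for q
    by (auto simp: sublinear_def cut_def)
  define A where "A = {q. sublinear q \<and> (\<forall>x\<in>V. q x \<le> p x) \<and> (\<forall>x. x \<notin> V \<longrightarrow> q x = 0)}"
  \<comment> \<open>The order is reversed, so that a maximal element in Zorn's lemma is a minimal
    functional.\<close>
  define R where "R = {(q, q'). q \<in> A \<and> q' \<in> A \<and> (\<forall>x\<in>V. q' x \<le> q x)}"
  have FR: "Field R = A" by (auto simp: R_def Field_def)
  have po: "Partial_order R"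
    unfolding partial_order_on_def preorder_on_def FR
  proof (intro conjI)
    show "R \<subseteq> A \<times> A" by (auto simp: R_def)
    show "refl_on A R" by (auto simp: R_def refl_on_def)
    show "trans R" unfolding R_def trans_def by (auto intro: order_trans)
    show "antisym R"
    proof (rule antisymI, rule ext)
      fix q q' x assume "(q, q') \<in> R" "(q', q) \<in> R"
      then show "q x = q' x" by (cases "x \<in> V") (auto simp: R_def A_def intro: antisym)
    qed
  qed
  have ub: "\<exists>u\<in>Field R. \<forall>a\<in>C. (a, u) \<in> R" if C: "C \<in> Chains R" for C
  proof (cases "C = {}")
    case True
    have "cut p \<in> A" using p by (simp add: A_def cut) (simp add: cut_def)
    then show ?thesis using True FR by auto
  next
    case False
    have CA: "q \<in> A" if "q \<in> C" for q
      using C that by (auto simp: Chains_def R_def)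
    have bd: "bdd_below ((\<lambda>q. q x) ` C)" if x: "x \<in> V" for x
    proof (rule bdd_belowI2)
      fix q assume "q \<in> C"
      then have "sublinear q" "q (- x) \<le> p (- x)" using CA x by (auto simp: A_def)
      then show "- p (- x) \<le> q x" using sublinear_minus_le[of q x] x by simp
    qed
    let ?I = "\<lambda>x. INF q\<in>C. q x"
    have I: "sublinear ?I"
      using False CA bd C
      by (intro sublinear_Inf_chain) (auto simp: A_def Chains_def R_def)
    have le: "?I x \<le> q x" if "q \<in> C" "x \<in> V" for q x
      using bd that by (intro cINF_lower)
    have "cut ?I \<in> A"
      using I False CA le by (simp add: A_def cut) (fastforce simp: cut_def intro: order_trans)
    then have "\<forall>a\<in>C. (a, cut ?I) \<in> R"
      using CA le by (auto simp: R_def cut_def)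
    then show ?thesis using FR \<open>cut ?I \<in> A\<close> by blast
  qed
  obtain q where q: "q \<in> A" and qm: "\<And>a. a \<in> A \<Longrightarrow> (q, a) \<in> R \<Longrightarrow> a = q"
    using Zorns_po_lemma[OF po ub] FR by auto
  show ?thesis
  proof (rule that[of q])
    fix q' x assume q': "sublinear q'" "\<forall>x\<in>V. q' x \<le> q x" and x: "x \<in> V"
    have "cut q' \<in> A"
      using q q' by (simp add: A_def cut) (fastforce simp: cut_def intro: order_trans)
    then have "cut q' = q"
      using q q' by (intro qm) (auto simp: R_def cut_def)
    then show "q' x = q x" using x by (auto simp: cut_def)
  qed (use q in \<open>auto simp: A_def\<close>)
qed

lemma real_linear_below_sublinear:
  assumes p: "sublinear p"
  obtains f :: "'a \<Rightarrow> real" where "\<And>x. x \<in> V \<Longrightarrow> f x \<le> p x"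
    "\<And>x y. x \<in> V \<Longrightarrow> y \<in> V \<Longrightarrow> f (x + y) = f x + f y"
    "\<And>t x. x \<in> V \<Longrightarrow> f (s (of_real t) x) = t * f x"
proof -
  obtain q where q: "sublinear q" and qp: "\<And>x. x \<in> V \<Longrightarrow> q x \<le> p x"
    and qm: "\<And>q' x. sublinear q' \<Longrightarrow> \<forall>x\<in>V. q' x \<le> q x \<Longrightarrow> x \<in> V \<Longrightarrow> q' x = q x"
    using minimal_sublinear[OF p] by blast
  have add: "q (x + y) = q x + q y" if xy: "x \<in> V" "y \<in> V" for x y
  proof -
    have "q x = tilt q y x"
      using qm[OF sublinear_tilt[OF q xy(2)] _ xy(1)] tilt_le_self[OF q _ xy(2)] by simp
    \<comment> \<open>With parameter 1 the fixed tilt yields superadditivity, the inequality missing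
      for additivity.\<close>
    also have "\<dots> \<le> q (x + y) - q y"
      using tilt_le[OF q xy, of 1] by simp
    finally show ?thesis using sublinear_add[OF q xy] by simp
  qed
  have neg: "q (- x) = - q x" if "x \<in> V" for x
    using add[of x "- x"] that sublinear_0[OF q] by simp
  have "q (s (of_real t) x) = t * q x" if x: "x \<in> V" for t x
  proof (cases "t \<ge> 0")
    case True
    then show ?thesis using sublinear_scale[OF q _ x] by simp
  next
    case False
    then have "q (- s (of_real (- t)) x) = t * q x"
      using sublinear_scale[OF q _ x, of "- t"] neg[of "s (of_real (- t)) x"] x by simp
    then show ?thesis by (simp add: scale_minus_left)
  qed
  then show ?thesis using that qp add by blast
qed

text \<open>The dual of the normed space \<open>(V, \<nu>)\<close>. Values outside \<open>V\<close>
  are unconstrained, so identities between functionals are meant on \<open>V\<close>.\<close>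

definition functionals :: "('a \<Rightarrow> complex) set"
  where "functionals = {f. (\<forall>x\<in>V. \<forall>y\<in>V. f (x + y) = f x + f y) \<and>
    (\<forall>c. \<forall>x\<in>V. f (s c x) = c * f x) \<and> (\<exists>C. \<forall>x\<in>V. cmod (f x) \<le> C * \<nu> x)}"

lemma functional_add: "f \<in> functionals \<Longrightarrow> x \<in> V \<Longrightarrow> y \<in> V \<Longrightarrow> f (x + y) = f x + f y"
  and functional_scale: "f \<in> functionals \<Longrightarrow> x \<in> V \<Longrightarrow> f (s c x) = c * f x"
  by (auto simp: functionals_def)

lemma functional_0: "f \<in> functionals \<Longrightarrow> f 0 = 0"
  using functional_scale[of f 0 0] by simp

lemma functional_minus: "f \<in> functionals \<Longrightarrow> x \<in> V \<Longrightarrow> f (- x) = - f x"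
  using functional_scale[of f x "-1"] by (simp add: scale_minus_left)

lemma functional_diff: "f \<in> functionals \<Longrightarrow> x \<in> V \<Longrightarrow> y \<in> V \<Longrightarrow> f (x - y) = f x - f y"
  using functional_add[of f x "- y"] functional_minus[of f y] by simp

lemma functional_sum:
  assumes f: "f \<in> functionals" and h: "\<And>i. i \<in> I \<Longrightarrow> h i \<in> V"
  shows "f (sum h I) = (\<Sum>i\<in>I. f (h i))"
  using h
proof (induction I rule: infinite_finite_induct)
  case (insert i I)
  then show ?case by (simp add: functional_add[OF f] V_sum)
qed (simp_all add: functional_0[OF f])

text \<open>A real linear functional below \<open>tilt \<nu> y\<close> is bounded by
  \<open>\<nu>\<close> and is at least \<open>\<nu> y\<close> at \<open>y\<close>. Complexification
  keeps the lower bound; the factor 2 comes from estimating real and imaginary parts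
  separately.\<close>

lemma norming_functional:
  assumes y: "y \<in> V"
  obtains f where "f \<in> functionals" "\<nu> y \<le> cmod (f y)" "\<And>x. x \<in> V \<Longrightarrow> cmod (f x) \<le> 2 * \<nu> x"
proof -
  have sub: "sublinear \<nu>"
    by (auto simp: sublinear_def \<nu>_add \<nu>_scale)
  obtain g :: "'a \<Rightarrow> real" where gp: "\<And>x. x \<in> V \<Longrightarrow> g x \<le> tilt \<nu> y x"
    and add: "\<And>x y. x \<in> V \<Longrightarrow> y \<in> V \<Longrightarrow> g (x + y) = g x + g y"
    and sc: "\<And>t x. x \<in> V \<Longrightarrow> g (s (of_real t) x) = t * g x"
    using real_linear_below_sublinear[OF sublinear_tilt[OF sub y]] by blast
  have neg: "g (- x) = - g x" if "x \<in> V" for x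
    using sc[of x "-1"] that by (simp add: scale_minus_left)
  have g\<nu>: "\<bar>g x\<bar> \<le> \<nu> x" if "x \<in> V" for x
    using gp[of x] gp[of "- x"] tilt_le_self[OF sub _ y, of x] tilt_le_self[OF sub _ y, of "- x"]
      \<nu>_minus[of x] neg[of x] that by simp
  have "g (- y) \<le> tilt \<nu> y (- y)" using gp y by simp
  also have "\<dots> \<le> \<nu> (- y + s (of_real 1) y) - 1 * \<nu> y" using sub y by (intro tilt_le) auto
  also have "\<dots> = - \<nu> y" using sublinear_0[OF sub] by simp
  finally have gy: "\<nu> y \<le> g y" using neg[OF y] by simp
  \<comment> \<open>The only complex linear functional with real part \<open>g\<close>.\<close>
  define f where "f x = Complex (g x) (- g (s \<i> x))" for x
  have f2: "cmod (f x) \<le> 2 * \<nu> x" if x: "x \<in> V" for x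
  proof -
    have "cmod (f x) \<le> \<bar>g x\<bar> + \<bar>g (s \<i> x)\<bar>"
      using cmod_le[of "f x"] by (simp add: f_def)
    also have "\<dots> \<le> 2 * \<nu> x"
      using g\<nu>[of x] g\<nu>[of "s \<i> x"] x by (simp add: \<nu>_scale)
    finally show ?thesis .
  qed
  have fs: "f (s c x) = c * f x" if x: "x \<in> V" for c x
  proof -
    have c: "c = of_real (Re c) + of_real (Im c) * \<i>"
      by (simp add: complex_eq_iff)
    have 1: "s c x = s (of_real (Re c)) x + s (of_real (Im c)) (s \<i> x)"
      by (subst c) (simp only: scale_left_distrib scale_scale)
    have "\<i> * c = of_real (Re c) * \<i> + of_real (- Im c)"
      by (simp add: complex_eq_iff)
    then have "s \<i> (s c x) = s (of_real (Re c)) (s \<i> x) + s (of_real (- Im c)) x"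
      by (simp only: scale_left_distrib scale_scale)
    then have "g (s \<i> (s c x)) = Re c * g (s \<i> x) - Im c * g x"
      using x by (simp only: add sc V_scale)
    moreover have "g (s c x) = Re c * g x + Im c * g (s \<i> x)"
      unfolding 1 using x by (simp only: add sc V_scale)
    ultimately show ?thesis
      by (simp only: f_def complex_eq_iff) (simp add: algebra_simps)
  qed
  have "f (x + x') = f x + f x'" if "x \<in> V" "x' \<in> V" for x x'
    using that by (simp add: f_def complex_eq_iff add scale_right_distrib)
  then have "f \<in> functionals"
    using f2 fs unfolding functionals_def by blast
  moreover have "\<nu> y \<le> cmod (f y)"
    using gy complex_Re_le_cmod[of "f y"] by (simp add: f_def)
  ultimately show ?thesis using that f2 by blast
qed

lemma separating_functional:
  assumes "x \<in> V" "x \<noteq> 0"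
  obtains f where "f \<in> functionals" "f x \<noteq> 0"
  using norming_functional[OF assms(1)] \<nu>_eq_0[OF assms(1)] \<nu>_nonneg[OF assms(1)] assms(2)
  by (metis norm_zero order_antisym)

lemma functionals_lincomb:
  assumes "f \<in> functionals" "h \<in> functionals"
  shows "(\<lambda>x. a * f x + b * h x) \<in> functionals"
proof -
  obtain C D where C: "\<And>x. x \<in> V \<Longrightarrow> cmod (f x) \<le> C * \<nu> x" and D: "\<And>x. x \<in> V \<Longrightarrow> cmod (h x) \<le> D * \<nu> x"
    using assms unfolding functionals_def by blast
  have "cmod (a * f x + b * h x) \<le> (cmod a * C + cmod b * D) * \<nu> x" if "x \<in> V" for x
  proof -
    have "cmod (a * f x + b * h x) \<le> cmod a * cmod (f x) + cmod b * cmod (h x)"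
      by (metis norm_mult norm_triangle_ineq)
    also have "\<dots> \<le> cmod a * (C * \<nu> x) + cmod b * (D * \<nu> x)"
      using C D that by (intro add_mono mult_left_mono) auto
    finally show ?thesis by (simp add: algebra_simps)
  qed
  then have "\<exists>C. \<forall>x\<in>V. cmod (a * f x + b * h x) \<le> C * \<nu> x" by blast
  then show ?thesis
    by (simp add: functionals_def functional_add[OF assms(1)] functional_add[OF assms(2)]
        functional_scale[OF assms(1)] functional_scale[OF assms(2)] algebra_simps)
qed

lemma functionals_sum:
  assumes "finite I" "\<And>i. i \<in> I \<Longrightarrow> g i \<in> functionals"
  shows "(\<lambda>x. \<Sum>i\<in>I. g i x * c i) \<in> functionals"
  using assms
proof (induction I rule: finite_induct)
  case empty
  have "\<exists>C. \<forall>x\<in>V. 0 \<le> C * \<nu> x" by (rule exI[of _ 0]) simp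
  then show ?case by (simp add: functionals_def)
next
  case (insert i I)
  have "(\<lambda>x. c i * g i x + 1 * (\<Sum>i\<in>I. g i x * c i)) \<in> functionals"
    using insert by (intro functionals_lincomb) auto
  then show ?case using insert by (simp add: mult.commute)
qed

subsection \<open>Biorthogonal sequences\<close>

text \<open>A finite stage of the construction: \<open>e\<close> and \<open>g\<close> are total, but
  only their first \<open>n\<close> entries matter, so that adjoining a pair is a function
  update.\<close>

definition biorth :: "nat \<Rightarrow> (nat \<Rightarrow> 'a) \<Rightarrow> (nat \<Rightarrow> 'a \<Rightarrow> complex) \<Rightarrow> bool"
  where "biorth n e g \<longleftrightarrow> (\<forall>i<n. e i \<in> V \<and> g i \<in> functionals) \<and>
    (\<forall>i<n. \<forall>j<n. g i (e j) = (if i = j then 1 else 0))"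

text \<open>For a biorthogonal system this is the projection along the span of the first
  \<open>n\<close> vectors onto the common kernel of the first \<open>n\<close> functionals. So
  \<open>resid n e g x = 0\<close> encodes that \<open>x\<close> lies in that span, and the
  vanishing of \<open>f\<close> on all residuals encodes that \<open>f\<close> is on
  \<open>V\<close> a combination of the functionals.\<close>

definition resid :: "nat \<Rightarrow> (nat \<Rightarrow> 'a) \<Rightarrow> (nat \<Rightarrow> 'a \<Rightarrow> complex) \<Rightarrow> 'a \<Rightarrow> 'a"
  where "resid n e g x = x - (\<Sum>i<n. s (g i x) (e i))"

lemma resid_cong:
  "(\<And>i. i < n \<Longrightarrow> e i = e' i \<and> g i = g' i) \<Longrightarrow> resid n e g x = resid n e' g' x"
  by (auto simp: resid_def intro!: sum.cong)

lemma resid_in: "biorth n e g \<Longrightarrow> x \<in> V \<Longrightarrow> resid n e g x \<in> V"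
  by (auto simp: biorth_def resid_def intro!: V_sum V_diff)

lemma functional_resid:
  assumes "biorth n e g" "f \<in> functionals" "x \<in> V"
  shows "f (resid n e g x) = f x - (\<Sum>i<n. g i x * f (e i))"
proof -
  have *: "s (g i x) (e i) \<in> V" if "i < n" for i
    using assms that by (auto simp: biorth_def)
  then have "f (\<Sum>i<n. s (g i x) (e i)) = (\<Sum>i<n. g i x * f (e i))"
    using assms by (subst functional_sum) (auto simp: biorth_def functional_scale)
  moreover have "(\<Sum>i<n. s (g i x) (e i)) \<in> V"
    using * by (intro V_sum) auto
  ultimately show ?thesis
    using assms by (simp add: resid_def functional_diff)
qed

text \<open>On \<open>V\<close> the composition is a linear combination of \<open>f\<close> and the
  \<open>g i\<close>, hence again bounded by a multiple of \<open>\<nu>\<close>.\<close>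

lemma functional_comp_resid:
  assumes "biorth n e g" "f \<in> functionals"
  obtains h where "h \<in> functionals" "\<And>x. x \<in> V \<Longrightarrow> h x = f (resid n e g x)"
proof
  show "(\<lambda>x. 1 * f x + (- 1) * (\<Sum>i<n. g i x * f (e i))) \<in> functionals"
    using assms by (intro functionals_lincomb functionals_sum) (auto simp: biorth_def)
qed (simp add: functional_resid assms)

lemma biorth_resid_eq_0:
  assumes b: "biorth n e g" and j: "j < n" and x: "x \<in> V"
  shows "g j (resid n e g x) = 0"
proof -
  have "g j (resid n e g x) = g j x - (\<Sum>i<n. g i x * g j (e i))"
    using assms by (intro functional_resid) (auto simp: biorth_def)
  also have "(\<Sum>i<n. g i x * g j (e i)) = (\<Sum>i<n. if j = i then g i x else 0)"
    using b j by (intro sum.cong) (auto simp: biorth_def)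
  finally show ?thesis using j by simp
qed

lemma resid_biorth_eq_0:
  assumes b: "biorth n e g" and j: "j < n"
  shows "resid n e g (e j) = 0"
proof -
  have "(\<Sum>i<n. s (g i (e j)) (e i)) = (\<Sum>i<n. if i = j then e i else 0)"
    using b j by (intro sum.cong) (auto simp: biorth_def)
  then show ?thesis using j by (simp add: resid_def)
qed

lemma resid_idem:
  assumes b: "biorth n e g" and x: "x \<in> V"
  shows "resid n e g (resid n e g x) = resid n e g x"
  unfolding resid_def[of _ _ _ "resid n e g x"]
  using biorth_resid_eq_0[OF b _ x] by simp

text \<open>
  The single step of the construction: adjoining \<open>r = resid n e g y\<close> together with
  \<open>(f \<circ> resid n e g) / f r\<close> puts \<open>y\<close> into the span of the vectors and \<open>f\<close> into the span of the
  functionals.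
\<close>

lemma biorth_extend:
  assumes b: "biorth n e g" and f: "f \<in> functionals" and y: "y \<in> V" and ne: "f (resid n e g y) \<noteq> 0"
  obtains e' g' where "biorth (Suc n) e' g'" "\<And>i. i < n \<Longrightarrow> e' i = e i \<and> g' i = g i"
    "resid (Suc n) e' g' y = 0" "\<And>x. x \<in> V \<Longrightarrow> f (resid (Suc n) e' g' x) = 0"
proof -
  define r where "r = resid n e g y"
  have r: "r \<in> V" "f r \<noteq> 0" "resid n e g r = r" "\<And>j. j < n \<Longrightarrow> g j r = 0"
    using b y ne by (auto simp: r_def resid_in resid_idem biorth_resid_eq_0)
  obtain h where h: "h \<in> functionals" "\<And>x. x \<in> V \<Longrightarrow> h x = f (resid n e g x)"
    using functional_comp_resid[OF b f] by blast
  \<comment> \<open>The zero term only brings the scalar multiple into the shape of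
    \<open>functionals_lincomb\<close>.\<close>
  define h' where "h' x = (1 / f r) * h x + 0 * h x" for x
  have h': "h' \<in> functionals"
    unfolding h'_def by (intro functionals_lincomb h)
  have h'x: "h' x = f (resid n e g x) / f r" if "x \<in> V" for x
    using h that by (simp add: h'_def)
  have h'e: "h' (e j) = 0" if "j < n" for j
    using h'x[of "e j"] resid_biorth_eq_0[OF b that] b that f by (auto simp: biorth_def functional_0)
  define e' g' where "e' = e(n := r)" and "g' = g(n := h')"
  \<comment> \<open>The scaling of \<open>h'\<close> serves both aims: \<open>h' y = 1\<close> makes
    the new residual of \<open>y\<close> vanish, and \<open>f\<close> maps \<open>s (h' x) r\<close>
    to \<open>f (resid n e g x)\<close>, which cancels the first term.\<close>
  have res: "resid (Suc n) e' g' x = resid n e g x - s (h' x) r" if "x \<in> V" for x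
    by (simp add: resid_def e'_def g'_def diff_diff_eq)
  show ?thesis
  proof (rule that)
    show "biorth (Suc n) e' g'"
      using b r h' h'e h'x[of r] by (auto simp: biorth_def e'_def g'_def less_Suc_eq)
    show "e' i = e i \<and> g' i = g i" if "i < n" for i
      using that by (simp add: e'_def g'_def)
    show "resid (Suc n) e' g' y = 0"
      using y h'x[OF y] r(2) by (simp add: res flip: r_def)
    show "f (resid (Suc n) e' g' x) = 0" if x: "x \<in> V" for x
      using x h'x[OF x] r f resid_in[OF b x]
      by (simp add: res functional_diff functional_scale)
  qed
qed

definition biorth_ext ::
    "nat \<times> (nat \<Rightarrow> 'a) \<times> (nat \<Rightarrow> 'a \<Rightarrow> complex) \<Rightarrow> nat \<times> (nat \<Rightarrow> 'a) \<times> (nat \<Rightarrow> 'a \<Rightarrow> complex) \<Rightarrow> bool"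
  where "biorth_ext = (\<lambda>(n, e, g) (n', e', g'). n \<le> n' \<and> biorth n' e' g' \<and>
    (\<forall>i<n. e' i = e i \<and> g' i = g i))"

lemma biorth_ext_trans: "biorth_ext S S' \<Longrightarrow> biorth_ext S' S'' \<Longrightarrow> biorth_ext S S''"
  by (auto simp: biorth_ext_def split: prod.splits)

text \<open>At most two adjunctions capture \<open>x\<close> and \<open>f\<close>; infinite
  dimension permits another one, which makes \<open>n\<close> grow strictly. The index
  \<open>m\<close> refers to a prefix of the system, so later extensions preserve both
  properties.\<close>

lemma biorth_step:
  assumes b: "biorth n e g" and inf: "infinite_dimensional s V"
    and x: "x \<in> V" and f: "f \<in> functionals"
  obtains n' e' g' where "biorth_ext (n, e, g) (n', e', g')" "n < n'"
    "\<exists>m\<le>n'. resid m e' g' x = 0" "\<exists>m\<le>n'. \<forall>y\<in>V. f (resid m e' g' y) = 0"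
proof -
  obtain n1 e1 g1 where 1: "biorth_ext (n, e, g) (n1, e1, g1)" "resid n1 e1 g1 x = 0"
  proof (cases "resid n e g x = 0")
    case True
    then show ?thesis using that[of n e g] b by (auto simp: biorth_ext_def)
  next
    case False
    \<comment> \<open>A nonzero residual of \<open>x\<close> needs as partner a functional not
      vanishing on it. For \<open>f\<close> the roles are exchanged below, and the partner is a
      vector.\<close>
    then obtain h where h: "h \<in> functionals" "h (resid n e g x) \<noteq> 0"
      using separating_functional resid_in[OF b x] by blast
    obtain e' g' where "biorth (Suc n) e' g'" "\<And>i. i < n \<Longrightarrow> e' i = e i \<and> g' i = g i"
        "resid (Suc n) e' g' x = 0"
      using biorth_extend[OF b h(1) x h(2)] by metis
    then show ?thesis using that[of "Suc n" e' g'] by (auto simp: biorth_ext_def)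
  qed
  have b1: "biorth n1 e1 g1" using 1 by (auto simp: biorth_ext_def)
  obtain n2 e2 g2 where 2: "biorth_ext (n1, e1, g1) (n2, e2, g2)"
    "\<And>y. y \<in> V \<Longrightarrow> f (resid n2 e2 g2 y) = 0"
  proof (cases "\<forall>y\<in>V. f (resid n1 e1 g1 y) = 0")
    case True
    then show ?thesis using that[of n1 e1 g1] b1 by (auto simp: biorth_ext_def)
  next
    case False
    then obtain y where y: "y \<in> V" "f (resid n1 e1 g1 y) \<noteq> 0" by blast
    obtain e' g' where "biorth (Suc n1) e' g'" "\<And>i. i < n1 \<Longrightarrow> e' i = e1 i \<and> g' i = g1 i"
        "\<And>y. y \<in> V \<Longrightarrow> f (resid (Suc n1) e' g' y) = 0"
      using biorth_extend[OF b1 f y] by metis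
    then show ?thesis using that[of "Suc n1" e' g'] by (auto simp: biorth_ext_def)
  qed
  have b2: "biorth n2 e2 g2" using 2 by (auto simp: biorth_ext_def)
  \<comment> \<open>If all residuals vanished, the finitely many \<open>e2 i\<close> would span
    \<open>V\<close>.\<close>
  have "\<exists>y\<in>V. resid n2 e2 g2 y \<noteq> 0"
  proof (rule ccontr)
    assume "\<not> ?thesis"
    then have "y = (\<Sum>i<n2. s (g2 i y) (e2 i))" if "y \<in> V" for y
      using that by (auto simp: resid_def)
    moreover have "(\<Sum>i<n2. s (g2 i y) (e2 i)) \<in> span (e2 ` {..<n2})" for y
      by (intro span_sum span_scale span_base) auto
    ultimately have "V \<subseteq> span (e2 ` {..<n2})" by (metis subsetI)
    moreover have "e2 ` {..<n2} \<subseteq> V" using b2 by (auto simp: biorth_def)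
    ultimately have "finite (e2 ` {..<n2}) \<and> e2 ` {..<n2} \<subseteq> V \<and> span (e2 ` {..<n2}) = V"
      using span_minimal[OF _ subspace_V] by blast
    then show False using inf unfolding infinite_dimensional_def by blast
  qed
  then obtain y where y: "y \<in> V" "resid n2 e2 g2 y \<noteq> 0" by blast
  then obtain h where h: "h \<in> functionals" "h (resid n2 e2 g2 y) \<noteq> 0"
    using separating_functional resid_in[OF b2] by blast
  obtain e3 g3 where "biorth (Suc n2) e3 g3" and 3: "\<And>i. i < n2 \<Longrightarrow> e3 i = e2 i \<and> g3 i = g2 i"
    using biorth_extend[OF b2 h(1) y(1) h(2)] by metis
  then have ext: "biorth_ext (n2, e2, g2) (Suc n2, e3, g3)"
    by (auto simp: biorth_ext_def)
  have "n \<le> n1" "n1 \<le> n2" using 1 2 by (auto simp: biorth_ext_def)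
  have "resid n2 e3 g3 z = resid n2 e2 g2 z" for z
    using 3 by (intro resid_cong) auto
  moreover have "resid n1 e3 g3 z = resid n1 e1 g1 z" for z
    using 2 3 \<open>n1 \<le> n2\<close> by (intro resid_cong) (auto simp: biorth_ext_def)
  ultimately have "resid n1 e3 g3 x = 0" "\<forall>z\<in>V. f (resid n2 e3 g3 z) = 0"
    using 1 2 by auto
  moreover have "biorth_ext (n, e, g) (Suc n2, e3, g3)"
    using 1 2 ext biorth_ext_trans by blast
  ultimately show ?thesis
    using that[of "Suc n2" e3 g3] \<open>n \<le> n1\<close> \<open>n1 \<le> n2\<close>
    by (metis le_SucI le_imp_less_Suc order_trans order_refl)
qed

text \<open>Dependent choice iterates the single step, treating \<open>X k\<close> and
  \<open>f k\<close> at stage \<open>k\<close>. The stages agree on common prefixes, so the infinite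
  sequences can be read off from them.\<close>

lemma biorthogonal_sequence:
  assumes inf: "infinite_dimensional s V"
    and X: "\<And>k::nat. X k \<in> V" and f: "\<And>k::nat. f k \<in> functionals"
  shows "\<exists>e g. (\<forall>n. biorth n e g) \<and> (\<forall>k. \<exists>m. resid m e g (X k) = 0) \<and>
    (\<forall>k. \<exists>m. \<forall>y\<in>V. f k (resid m e g y) = 0)"
proof -
  \<comment> \<open>The invariant \<open>k \<le> n\<close> ensures that the stages exhaust all
    indices.\<close>
  let ?P = "\<lambda>(k::nat) (n, e, g). biorth n e g \<and> k \<le> n"
  let ?Q = "\<lambda>k S S'. biorth_ext S S' \<and> (case S' of (n, e, g) \<Rightarrow>
    (\<exists>m\<le>n. resid m e g (X k) = 0) \<and> (\<exists>m\<le>n. \<forall>y\<in>V. f k (resid m e g y) = 0))"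
  have "\<exists>S. \<forall>k. ?P k (S k) \<and> ?Q k (S k) (S (Suc k))"
  proof (rule dependent_nat_choice)
    show "\<exists>S. ?P 0 S" by (auto simp: biorth_def)
  next
    fix S k assume "?P k S"
    moreover obtain n e g where S: "S = (n, e, g)" by (cases S)
    ultimately have b: "biorth n e g" "k \<le> n" by auto
    obtain n' e' g' where "biorth_ext (n, e, g) (n', e', g')" "n < n'"
      "\<exists>m\<le>n'. resid m e' g' (X k) = 0" "\<exists>m\<le>n'. \<forall>y\<in>V. f k (resid m e' g' y) = 0"
      using biorth_step[OF b(1) inf X f] by metis
    then show "\<exists>S'. ?P (Suc k) S' \<and> ?Q k S S'"
      using b S by (intro exI[of _ "(n', e', g')"]) (auto simp: biorth_ext_def)
  qed
  then obtain S where "\<forall>k. ?P k (S k) \<and> ?Q k (S k) (S (Suc k))" ..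
  then have S: "\<And>k. ?P k (S k)" "\<And>k. ?Q k (S k) (S (Suc k))" by simp_all
  define N E D where "N k = fst (S k)" and "E k = fst (snd (S k))" and "D k = snd (snd (S k))" for k
  have Sk: "S k = (N k, E k, D k)" for k by (simp add: N_def E_def D_def)
  have b: "biorth (N k) (E k) (D k)" "k \<le> N k" for k
    using S(1)[of k] by (auto simp: Sk)
  have ext: "biorth_ext (S k) (S l)" if "k \<le> l" for k l
    using that
  proof (induction l rule: dec_induct)
    case base
    show ?case using b by (auto simp: Sk biorth_ext_def)
  next
    case (step l)
    then show ?case using S(2)[of l] biorth_ext_trans by blast
  qed
  \<comment> \<open>Stage \<open>Suc i\<close> has length at least \<open>Suc i\<close>, so its
    entry at \<open>i\<close> is already final.\<close>
  define e g where "e i = E (Suc i) i" and "g i = D (Suc i) i" for i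
  have eg: "E k i = e i \<and> D k i = g i" if "i < N k" for k i
  proof (cases "k \<le> Suc i")
    case True
    then show ?thesis using ext[OF True] that by (auto simp: Sk biorth_ext_def e_def g_def)
  next
    case False
    moreover have "i < N (Suc i)" using b(2)[of "Suc i"] by simp
    ultimately show ?thesis
      using ext[of "Suc i" k] by (auto simp: Sk biorth_ext_def e_def g_def)
  qed
  have res: "resid m e g y = resid m (E k) (D k) y" if "m \<le> N k" for m k y
    using eg that by (intro resid_cong) auto
  show ?thesis
  proof (intro exI[of _ e] exI[of _ g] conjI allI)
    show "biorth n e g" for n
      using b(1)[of n] b(2)[of n] eg[of _ n] unfolding biorth_def by (metis less_le_trans)
    fix k
    let ?k = "Suc k"
    have "\<exists>m\<le>N ?k. resid m (E ?k) (D ?k) (X k) = 0"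
      and "\<exists>m\<le>N ?k. \<forall>y\<in>V. f k (resid m (E ?k) (D ?k) y) = 0"
      using S(2)[of k] by (simp_all add: Sk)
    then show "\<exists>m. resid m e g (X k) = 0" and "\<exists>m. \<forall>y\<in>V. f k (resid m e g y) = 0"
      using res by metis+
  qed
qed

end
subsection \<open>Entire power series\<close>

text \<open>Comparison with the exponential series gives convergence on the whole plane and the
  bound together. Holomorphy follows from discs of every radius.\<close>

lemma entire_series:
  fixes c :: "nat \<Rightarrow> complex"
  assumes c: "\<And>n. cmod (c n) \<le> B / fact n"
  defines "f \<equiv> \<lambda>z. \<Sum>n. c n * z ^ n"
  shows entire_series_sums: "(\<lambda>n. c n * z ^ n) sums f z"
    and entire_series_bound: "cmod (f z) \<le> B * exp (cmod z)"
    and entire_series_holomorphic: "f holomorphic_on UNIV"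
proof -
  have bd: "norm (c n * z ^ n) \<le> B * (cmod z ^ n /\<^sub>R fact n)" for n z
  proof -
    have "norm (c n * z ^ n) = cmod (c n) * cmod z ^ n"
      by (simp add: norm_mult norm_power)
    also have "\<dots> \<le> (B / fact n) * cmod z ^ n"
      by (intro mult_right_mono c) simp
    finally show ?thesis by (simp add: field_simps)
  qed
  have ex: "(\<lambda>n. B * (cmod z ^ n /\<^sub>R fact n)) sums (B * exp (cmod z))" for z :: complex
    by (intro sums_mult exp_converges)
  have sm: "summable (\<lambda>n. c n * z ^ n)" for z
    using bd ex[of z] by (intro summable_comparison_test'[OF sums_summable]) auto
  then show sums: "(\<lambda>n. c n * z ^ n) sums f z" for z
    unfolding f_def by (rule summable_sums)
  show "cmod (f z) \<le> B * exp (cmod z)"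
    unfolding f_def sums_unique[OF ex] using bd ex
    by (intro norm_suminf_le) (auto simp: sums_iff)
  have hol: "f holomorphic_on ball 0 r" for r
    using sums by (intro power_series_holomorphic[where a = c]) simp
  have "f field_differentiable at z" for z
    using hol[of "cmod z + 1"] by (rule holomorphic_on_imp_differentiable_at) simp_all
  then show "f holomorphic_on UNIV"
    by (simp add: holomorphic_on_def)
qed

text \<open>By the identity theorem the sum vanishes on the whole plane, in particular near 0, where
  uniqueness of the power series expansion makes the coefficients vanish.\<close>

lemma entire_series_eq_0:
  fixes c :: "nat \<Rightarrow> complex"
  assumes c: "\<And>n. cmod (c n) \<le> B / fact n" and G: "open G" "G \<noteq> {}"
    and 0: "\<And>z. z \<in> G \<Longrightarrow> (\<Sum>n. c n * z ^ n) = 0"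
  shows "c n = 0"
proof -
  obtain w where w: "w \<in> G" using G by blast
  have "(\<Sum>n. c n * z ^ n) = 0" for z
    by (rule analytic_continuation[OF entire_series_holomorphic[OF c] open_UNIV connected_UNIV
          subset_UNIV UNIV_I interior_limit_point[of w G] 0 UNIV_I])
      (use w G in \<open>simp_all add: interior_open\<close>)
  then have "(\<lambda>n. c n * z ^ n) sums 0" for z
    using entire_series_sums[OF c, of z] by simp
  then have "(\<lambda>_. 0) has_fps_expansion Abs_fps c"
    by (intro has_fps_expansionI) simp
  then have "Abs_fps c = 0"
    by (rule fps_expansion_unique_complex) simp
  then show ?thesis
    by (simp add: fps_eq_iff)
qed

subsection \<open>Seminorm topologies\<close>

text \<open>Differences carry an estimate at 0 to every point. The criterion has \<epsilon>-\<delta>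
  form, so that a neighbourhood of 0 on which a norm is small can be used directly.\<close>

lemma continuous_map_seminorm_topology:
  assumes fV: "\<And>x. x \<in> V \<Longrightarrow> f x \<in> V'"
    and V: "\<And>x y. x \<in> V \<Longrightarrow> y \<in> V \<Longrightarrow> x - y \<in> V"
    and diff: "\<And>x y. x \<in> V \<Longrightarrow> y \<in> V \<Longrightarrow> f (x - y) = f x - f y"
    and bd: "\<And>q \<epsilon>. q \<in> P' \<Longrightarrow> 0 < \<epsilon> \<Longrightarrow> \<exists>Q \<delta>. finite Q \<and> Q \<subseteq> P \<and> 0 < \<delta> \<and>
      (\<forall>x\<in>V. (\<forall>p\<in>Q. p x < \<delta>) \<longrightarrow> q (f x) < \<epsilon>)"
  shows "continuous_map (seminorm_topology V P) (seminorm_topology V' P') f"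
proof -
  have fin: "\<exists>Q \<delta>. finite Q \<and> Q \<subseteq> P \<and> 0 < \<delta> \<and>
      (\<forall>x\<in>V. (\<forall>p\<in>Q. p x < \<delta>) \<longrightarrow> (\<forall>q\<in>Q'. q (f x) < \<epsilon>))"
    if "finite Q'" "Q' \<subseteq> P'" and \<epsilon>: "0 < \<epsilon>" for Q' \<epsilon>
    using that(1,2)
  proof (induction Q' rule: finite_induct)
    case empty
    show ?case by (intro exI[of _ "{}"] exI[of _ 1]) simp
  next
    case (insert q Q')
    obtain Q1 d1 where 1: "finite Q1" "Q1 \<subseteq> P" "0 < d1"
      "\<And>x. x \<in> V \<Longrightarrow> (\<forall>p\<in>Q1. p x < d1) \<Longrightarrow> q (f x) < \<epsilon>"
      using bd[of q, OF _ \<epsilon>] insert.prems by auto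
    obtain Q2 d2 where 2: "finite Q2" "Q2 \<subseteq> P" "0 < d2"
      "\<And>x. x \<in> V \<Longrightarrow> (\<forall>p\<in>Q2. p x < d2) \<Longrightarrow> (\<forall>q\<in>Q'. q (f x) < \<epsilon>)"
      using insert by auto
    show ?case
      using 1 2 by (intro exI[of _ "Q1 \<union> Q2"] exI[of _ "min d1 d2"]) auto
  qed
  have "openin (seminorm_topology V P) {x \<in> V. f x \<in> U}" if U: "openin (seminorm_topology V' P') U" for U
    unfolding openin_seminorm_topology
  proof (intro conjI ballI)
    fix x assume x: "x \<in> {x \<in> V. f x \<in> U}"
    then obtain Q' \<epsilon> where Q': "finite Q'" "Q' \<subseteq> P'" "0 < \<epsilon>"
        and sub: "{y\<in>V'. \<forall>q\<in>Q'. q (y - f x) < \<epsilon>} \<subseteq> U"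
      using U unfolding openin_seminorm_topology by blast
    obtain Q \<delta> where Q: "finite Q" "Q \<subseteq> P" "0 < \<delta>"
      "\<And>x. x \<in> V \<Longrightarrow> (\<forall>p\<in>Q. p x < \<delta>) \<Longrightarrow> (\<forall>q\<in>Q'. q (f x) < \<epsilon>)"
      using fin[OF Q'] by blast
    have "f y \<in> U" if "y \<in> V" "\<forall>p\<in>Q. p (y - x) < \<delta>" for y
      using sub Q(4)[of "y - x"] that x diff[of y x] V fV by auto
    then show "\<exists>Q \<epsilon>. finite Q \<and> Q \<subseteq> P \<and> 0 < \<epsilon> \<and> {y\<in>V. \<forall>p\<in>Q. p (y - x) < \<epsilon>} \<subseteq> {x \<in> V. f x \<in> U}"
      using Q by (intro exI[of _ Q] exI[of _ \<delta>]) auto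
  qed auto
  then show ?thesis
    using fV by (simp add: continuous_map_def Pi_iff)
qed

text \<open>The seminorms on \<open>V'\<close> are those on \<open>V\<close> composed with the
  inverse of \<open>f\<close>, so \<open>f\<close> preserves each of them. A Cauchy sequence is
  pulled back to \<open>V\<close>, and its limit is pushed forward by continuity.\<close>

lemma frechet_space_transport:
  assumes fr: "frechet_space s V T" and vs': "vector_space s'" and sub': "module.subspace s' V'"
    and bij: "bij_betw f V V'"
    and add: "\<And>x y. x \<in> V \<Longrightarrow> y \<in> V \<Longrightarrow> f (x + y) = f x + f y"
    and scale: "\<And>c x. x \<in> V \<Longrightarrow> f (s c x) = s' c (f x)"
  obtains T' where "frechet_space s' V' T'" "homeomorphic_map T T' f"
proof -
  interpret vs: vector_space s using fr by (simp add: frechet_space_def)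
  interpret vs': vector_space s' by (rule vs')
  have sub: "vs.subspace V" using fr by (simp add: frechet_space_def)
  obtain p :: "nat \<Rightarrow> 'a \<Rightarrow> real" where
    p: "\<And>n. seminorm_on s V (p n)"
    and sep: "\<And>x. x \<in> V \<Longrightarrow> \<forall>n. p n x = 0 \<Longrightarrow> x = 0"
    and T: "T = seminorm_topology V (range p)"
    and complete: "\<And>X :: nat \<Rightarrow> 'a. range X \<subseteq> V \<Longrightarrow>
        \<forall>n. \<forall>\<epsilon>>0. \<exists>N. \<forall>i\<ge>N. \<forall>j\<ge>N. p n (X i - X j) < \<epsilon> \<Longrightarrow>
        \<exists>x\<in>V. limitin T X x sequentially"
    using fr unfolding frechet_space_def by blast
  define g where "g = inv_into V f"
  have fV: "f x \<in> V'" if "x \<in> V" for x using bij that by (auto simp: bij_betw_def)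
  have gV: "g u \<in> V" if "u \<in> V'" for u
    using bij that by (auto simp: g_def bij_betw_def inv_into_into)
  have gf: "g (f x) = x" if "x \<in> V" for x
    using bij that by (simp add: g_def bij_betw_def)
  have fg: "f (g u) = u" if "u \<in> V'" for u
    using bij that by (auto simp: g_def bij_betw_def f_inv_into_f)
  have g_add: "g (u + v) = g u + g v" if "u \<in> V'" "v \<in> V'" for u v
    using gf[of "g u + g v"] that gV add fg vs.subspace_add[OF sub] by metis
  have g_scale: "g (s' c u) = s c (g u)" if "u \<in> V'" for c u
    using gf[of "s c (g u)"] that gV scale fg vs.subspace_scale[OF sub] by metis
  have f_diff: "f (x - y) = f x - f y" if "x \<in> V" "y \<in> V" for x y
    using add[of "x - y" y] that vs.subspace_diff[OF sub] by simp
  have g_diff: "g (u - v) = g u - g v" if "u \<in> V'" "v \<in> V'" for u v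
    using g_add[of "u - v" v] that vs'.subspace_diff[OF sub'] by simp
  define p' where "p' n = (\<lambda>u. p n (g u))" for n
  define T' where "T' = seminorm_topology V' (range p')"
  have cf: "continuous_map T T' f"
    unfolding T T'_def
  proof (rule continuous_map_seminorm_topology)
    fix q and \<epsilon> :: real assume "q \<in> range p'" "0 < \<epsilon>"
    then obtain n where "q = p' n" by blast
    then show "\<exists>Q \<delta>. finite Q \<and> Q \<subseteq> range p \<and> 0 < \<delta> \<and> (\<forall>x\<in>V. (\<forall>p\<in>Q. p x < \<delta>) \<longrightarrow> q (f x) < \<epsilon>)"
      using \<open>0 < \<epsilon>\<close> by (intro exI[of _ "{p n}"] exI[of _ \<epsilon>]) (auto simp: p'_def gf)
  qed (auto simp: fV f_diff vs.subspace_diff[OF sub])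
  have cg: "continuous_map T' T g"
    unfolding T T'_def
  proof (rule continuous_map_seminorm_topology)
    fix q and \<epsilon> :: real assume "q \<in> range p" "0 < \<epsilon>"
    then obtain n where "q = p n" by blast
    then show "\<exists>Q \<delta>. finite Q \<and> Q \<subseteq> range p' \<and> 0 < \<delta> \<and> (\<forall>x\<in>V'. (\<forall>p\<in>Q. p x < \<delta>) \<longrightarrow> q (g x) < \<epsilon>)"
      using \<open>0 < \<epsilon>\<close> by (intro exI[of _ "{p' n}"] exI[of _ \<epsilon>]) (auto simp: p'_def)
  qed (auto simp: gV g_diff vs'.subspace_diff[OF sub'])
  have "homeomorphic_maps T T' f g"
    using cf cg gf fg by (simp add: homeomorphic_maps_def T T'_def)
  then have hom: "homeomorphic_map T T' f"
    unfolding homeomorphic_map_maps by blast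
  have semi: "seminorm_on s' V' (p' n)" for n
    using p[of n] gV by (simp add: seminorm_on_def p'_def g_add g_scale)
  have sep': "u = 0" if u: "u \<in> V'" "\<forall>n. p' n u = 0" for u
  proof -
    have "g u = 0" using sep[OF gV[OF u(1)]] u(2) by (simp add: p'_def)
    then show ?thesis
      using fg[OF u(1)] f_diff[of 0 0] vs.subspace_0[OF sub] by simp
  qed
  have compl: "\<exists>u\<in>V'. limitin T' X u sequentially"
    if X: "range X \<subseteq> V'" and cau: "\<forall>n. \<forall>\<epsilon>>0. \<exists>N. \<forall>i\<ge>N. \<forall>j\<ge>N. p' n (X i - X j) < \<epsilon>" for X :: "nat \<Rightarrow> 'b"
  proof -
    have XV: "X i \<in> V'" for i using X by auto
    have "\<exists>x\<in>V. limitin T (\<lambda>i. g (X i)) x sequentially"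
    proof (rule complete)
      show "range (\<lambda>i. g (X i)) \<subseteq> V" using XV gV by auto
      show "\<forall>n. \<forall>\<epsilon>>0. \<exists>N. \<forall>i\<ge>N. \<forall>j\<ge>N. p n (g (X i) - g (X j)) < \<epsilon>"
        using cau by (simp add: p'_def g_diff XV)
    qed
    then obtain x where x: "x \<in> V" "limitin T (\<lambda>i. g (X i)) x sequentially" by blast
    have "limitin T' (f \<circ> (\<lambda>i. g (X i))) (f x) sequentially"
      by (rule continuous_map_limit[OF cf x(2)])
    moreover have "f \<circ> (\<lambda>i. g (X i)) = X" using XV fg by auto
    ultimately show ?thesis using x fV by auto
  qed
  have "frechet_space s' V' T'"
    unfolding frechet_space_def
    using vs' sub' semi sep' compl T'_def by blast
  then show ?thesis using that hom by blast
qed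

subsection \<open>The embedding into the entire functions\<close>

lemma fun_scale_apply [simp]: "fun_scale c f z = c * f z"
  by (simp add: fun_scale_def)

lemma vector_space_fun_scale: "vector_space fun_scale"
  by unfold_locales (simp_all add: fun_eq_iff algebra_simps)

context normed_carrier
begin

text \<open>The exponential bound later yields continuity into the space of holomorphic functions;
  the two clauses about polynomials yield their density.\<close>

lemma ex_holomorphic_embedding:
  assumes inf: "infinite_dimensional s V"
    and X: "\<And>k::nat. X k \<in> V"
    and dense: "\<And>x \<epsilon>. x \<in> V \<Longrightarrow> 0 < \<epsilon> \<Longrightarrow> \<exists>k. \<nu> (X k - x) < \<epsilon>"
    and G: "open G" "G \<noteq> {}"
  shows "\<exists>\<Phi>. (\<forall>x\<in>V. \<forall>y\<in>V. \<Phi> (x + y) = \<Phi> x + \<Phi> y) \<and>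
    (\<forall>c. \<forall>x\<in>V. \<Phi> (s c x) = fun_scale c (\<Phi> x)) \<and>
    inj_on \<Phi> V \<and> \<Phi> ` V \<subseteq> hol_space G \<and>
    (\<forall>x\<in>V. \<forall>z. cmod (\<Phi> x z) \<le> \<nu> x * exp (cmod z)) \<and>
    polynomials_on G \<subseteq> \<Phi> ` V \<and> (\<forall>k. \<Phi> (X k) \<in> polynomials_on G)"
proof -
  have "\<forall>k. \<exists>f. f \<in> functionals \<and> \<nu> (X k) \<le> cmod (f (X k)) \<and> (\<forall>x\<in>V. cmod (f x) \<le> 2 * \<nu> x)"
  proof
    fix k
    obtain f where "f \<in> functionals" "\<nu> (X k) \<le> cmod (f (X k))" "\<And>x. x \<in> V \<Longrightarrow> cmod (f x) \<le> 2 * \<nu> x"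
      by (rule norming_functional[OF X]) blast
    then show "\<exists>f. f \<in> functionals \<and> \<nu> (X k) \<le> cmod (f (X k)) \<and> (\<forall>x\<in>V. cmod (f x) \<le> 2 * \<nu> x)"
      by blast
  qed
  then obtain f where f: "\<And>k. f k \<in> functionals" "\<And>k. \<nu> (X k) \<le> cmod (f k (X k))"
    and f2: "\<And>k x. x \<in> V \<Longrightarrow> cmod (f k x) \<le> 2 * \<nu> x"
    by metis
  have f_total: "x = 0" if x: "x \<in> V" and 0: "\<And>k. f k x = 0" for x
  proof (rule ccontr)
    assume "x \<noteq> 0"
    \<comment> \<open>A quarter suffices: as \<open>f k x = 0\<close>, \<open>\<nu> (X k)\<close> is
      then below \<open>\<nu> x / 2\<close>, and \<open>\<nu> x\<close> would be below three
      quarters of itself.\<close>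
    then have "0 < \<nu> x / 4" using \<nu>_eq_0[OF x] \<nu>_nonneg[OF x] by force
    then obtain k where k: "\<nu> (X k - x) < \<nu> x / 4" using dense[OF x] by blast
    have "\<nu> (X k) \<le> cmod (f k (X k - x))"
      using f[of k] 0[of k] X x by (simp add: functional_diff)
    also have "\<dots> \<le> 2 * \<nu> (X k - x)" using f2 X x by simp
    finally have "\<nu> (X k) < \<nu> x / 2" using k by simp
    moreover have "\<nu> x \<le> \<nu> (x - X k) + \<nu> (X k)"
      using \<nu>_add[of "x - X k" "X k"] X x by simp
    ultimately show False
      using k \<nu>_minus_commute[OF x X[of k]] \<open>0 < \<nu> x / 4\<close> by simp
  qed
  obtain e g where b: "\<And>n. biorth n e g" and Xk: "\<And>k. \<exists>m. resid m e g (X k) = 0"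
    and fk: "\<And>k. \<exists>m. \<forall>y\<in>V. f k (resid m e g y) = 0"
    using biorthogonal_sequence[of X f, OF inf X f(1)] by blast
  have e: "e i \<in> V" and g: "g i \<in> functionals" and ge: "g i (e j) = (if i = j then 1 else 0)" for i j
    using b[of "Suc (max i j)"] by (auto simp: biorth_def)
  \<comment> \<open>Each \<open>f k\<close> is on \<open>V\<close> a combination of finitely many
    \<open>g i\<close>, so the \<open>g i\<close> inherit the separation of points.\<close>
  have g_total: "x = 0" if x: "x \<in> V" and 0: "\<And>n. g n x = 0" for x
  proof (rule f_total[OF x])
    fix k
    obtain m where "f k (resid m e g x) = 0" using fk x by blast
    then show "f k x = 0" by (simp add: resid_def 0)
  qed
  have "\<exists>C>0. \<forall>x\<in>V. cmod (g n x) \<le> C * \<nu> x" for n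
  proof -
    obtain C where C: "\<And>x. x \<in> V \<Longrightarrow> cmod (g n x) \<le> C * \<nu> x"
      using g[of n] unfolding functionals_def by blast
    \<comment> \<open>The maximum with 1 makes the constant positive, as division by it
      requires.\<close>
    have "cmod (g n x) \<le> max C 1 * \<nu> x" if "x \<in> V" for x
      using C[OF that] mult_right_mono[OF max.cobounded1[of C 1] \<nu>_nonneg[OF that]] by linarith
    then show ?thesis by (intro exI[of _ "max C 1"]) auto
  qed
  then obtain C where C0: "\<And>n. C n > 0" and C: "\<And>n x. x \<in> V \<Longrightarrow> cmod (g n x) \<le> C n * \<nu> x"
    by metis
  \<comment> \<open>The weight absorbs the bound of \<open>g n\<close> and contributes a factorial,
    so that \<open>a n * g n x\<close> is at most \<open>\<nu> x / fact n\<close> in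
    modulus.\<close>
  define a where "a n = complex_of_real (1 / (C n * fact n))" for n
  have a0: "a n \<noteq> 0" for n using C0[of n] by (simp add: a_def)
  have bd: "cmod (a n * g n x) \<le> \<nu> x / fact n" if "x \<in> V" for n x
    using C[OF that, of n] C0[of n] by (simp add: a_def norm_mult norm_divide field_simps)
  define J where "J x z = (\<Sum>n. (a n * g n x) * z ^ n)" for x z
  define \<Phi> where "\<Phi> x = restrict0 G (J x)" for x
  have sums: "(\<lambda>n. (a n * g n x) * z ^ n) sums J x z" if "x \<in> V" for x z
    unfolding J_def using entire_series_sums[OF bd[OF that]] by simp
  have J_add: "J (x + y) z = J x z + J y z" if "x \<in> V" "y \<in> V" for x y z
    using sums_add[OF sums[OF that(1)] sums[OF that(2)], of z z] sums[of "x + y" z] that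
    by (intro sums_unique2) (auto simp: functional_add[OF g] algebra_simps)
  have J_scale: "J (s c x) z = c * J x z" if "x \<in> V" for c x z
    using sums_mult[OF sums[OF that], of c z] sums[of "s c x" z] that
    by (intro sums_unique2) (auto simp: functional_scale[OF g] algebra_simps)
  have \<Phi>_add: "\<Phi> (x + y) = \<Phi> x + \<Phi> y" if "x \<in> V" "y \<in> V" for x y
    using J_add[OF that] by (auto simp: \<Phi>_def restrict0_def)
  have \<Phi>_scale: "\<Phi> (s c x) = fun_scale c (\<Phi> x)" if "x \<in> V" for c x
    using J_scale[OF that] by (auto simp: \<Phi>_def restrict0_def)
  \<comment> \<open>Both clauses about polynomials rest on this: \<open>g n\<close> picks out
    \<open>d n\<close>, so finite combinations of the \<open>e i\<close> give polynomials, and every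
    polynomial arises since \<open>a n \<noteq> 0\<close>.\<close>
  have J_poly: "J (\<Sum>i<m. s (d i) (e i)) z = poly (\<Sum>n<m. monom (a n * d n) n) z" for m d z
  proof -
    have gn: "g n (\<Sum>i<m. s (d i) (e i)) = (if n < m then d n else 0)" for n
    proof -
      have "g n (\<Sum>i<m. s (d i) (e i)) = (\<Sum>i<m. g n (s (d i) (e i)))"
        using e by (intro functional_sum[OF g]) auto
      also have "\<dots> = (\<Sum>i<m. if n = i then d i else 0)"
        by (intro sum.cong) (auto simp: functional_scale[OF g e] ge)
      finally show ?thesis by simp
    qed
    have "J (\<Sum>i<m. s (d i) (e i)) z = (\<Sum>n<m. (a n * d n) * z ^ n)"
      unfolding J_def by (subst suminf_finite[of "{..<m}"]) (auto simp: gn)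
    then show ?thesis by (simp add: poly_sum poly_monom)
  qed
  show ?thesis
  proof (intro exI[of _ \<Phi>] conjI allI ballI)
    show "inj_on \<Phi> V"
    proof (rule inj_onI)
      fix x y assume x: "x \<in> V" and y: "y \<in> V" and eq: "\<Phi> x = \<Phi> y"
      have "J (x - y) z = 0" if "z \<in> G" for z
        using J_add[of "x - y" y z] x y fun_cong[OF eq, of z] that by (simp add: \<Phi>_def restrict0_def)
      then have "a n * g n (x - y) = 0" for n
        using x y by (intro entire_series_eq_0[OF bd[of "x - y"] G]) (auto simp: J_def)
      then show "x = y" using g_total[of "x - y"] a0 x y by simp
    qed
    show "\<Phi> ` V \<subseteq> hol_space G"
    proof
      fix h assume "h \<in> \<Phi> ` V"
      then obtain x where x: "x \<in> V" "h = \<Phi> x" by blast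
      have "J x holomorphic_on G"
        using entire_series_holomorphic[OF bd[OF x(1)]] unfolding J_def[abs_def]
        by (rule holomorphic_on_subset) simp
      then have "h holomorphic_on G"
        by (rule holomorphic_transform) (simp add: x \<Phi>_def restrict0_def)
      then show "h \<in> hol_space G" by (simp add: hol_space_def x \<Phi>_def restrict0_def)
    qed
    show "cmod (\<Phi> x z) \<le> \<nu> x * exp (cmod z)" if "x \<in> V" for x z
      using entire_series_bound[OF bd[OF that], of z] \<nu>_nonneg[OF that]
      by (simp add: \<Phi>_def restrict0_def J_def)
    show "polynomials_on G \<subseteq> \<Phi> ` V"
    proof
      fix h assume "h \<in> polynomials_on G"
      then obtain q where q: "h = restrict0 G (poly q)" by (auto simp: polynomials_on_def)
      let ?x = "\<Sum>i<Suc (degree q). s (coeff q i / a i) (e i)"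
      have J_x: "J ?x z = poly q z" for z
        using a0 unfolding J_poly by (simp add: lessThan_Suc_atMost poly_as_sum_of_monoms)
      have "h = \<Phi> ?x" by (simp only: q \<Phi>_def restrict0_def J_x)
      moreover have "?x \<in> V" using e by (intro V_sum) auto
      ultimately show "h \<in> \<Phi> ` V" by blast
    qed
    show "\<Phi> (X k) \<in> polynomials_on G" for k
    proof -
      obtain m where "resid m e g (X k) = 0" using Xk by blast
      then have X_k: "(\<Sum>i<m. s (g i (X k)) (e i)) = X k" by (simp add: resid_def)
      have "J (X k) = poly (\<Sum>n<m. monom (a n * g n (X k)) n)"
        using J_poly[where m = m and d = "\<lambda>i. g i (X k)"] unfolding X_k by (rule ext)
      then show ?thesis by (auto simp: \<Phi>_def polynomials_on_def)
    qed
  qed (auto simp: \<Phi>_add \<Phi>_scale)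
qed

end

section \<open>Transfer of the Frechet structure to the image of the embedding\<close>

theorem theorem2p2:
  fixes s :: "complex \<Rightarrow> 'a::ab_group_add \<Rightarrow> 'a"
    and F :: "'a set"
    and T :: "'a topology"
    and G :: "complex set"
  assumes "frechet_space s F T"
    and "separable_space T"
    and "infinite_dimensional s F"
    and "has_continuous_norm s F T"
    and "open G" and "connected G" and "G \<noteq> {}"
  shows "\<exists>E T\<^sub>E. frechet_space_of_holomorphic_functions G E T\<^sub>E \<and>
           isomorphic_tvs s F T fun_scale E T\<^sub>E \<and>
           T\<^sub>E closure_of (polynomials_on G) = E"
proof -
  obtain p :: "nat \<Rightarrow> 'a \<Rightarrow> real" where T: "T = seminorm_topology F (range p)"
    using assms(1) unfolding frechet_space_def by blast
  have topF: "topspace T = F" by (simp add: T)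
  obtain \<nu> where \<nu>: "norm_on s F \<nu>" "continuous_map T euclideanreal \<nu>"
    using assms(4) unfolding has_continuous_norm_def by blast
  interpret vector_space s using assms(1) by (simp add: frechet_space_def)
  interpret normed_carrier s F \<nu>
    using assms(1) \<nu>(1) by unfold_locales (auto simp: frechet_space_def)
  have nbhd: "\<exists>Q \<delta>. finite Q \<and> Q \<subseteq> range p \<and> 0 < \<delta> \<and> (\<forall>x\<in>F. (\<forall>q\<in>Q. q x < \<delta>) \<longrightarrow> \<nu> x < \<epsilon>)"
    if \<epsilon>: "0 < \<epsilon>" for \<epsilon>
  proof -
    have "openin T {x \<in> topspace T. \<nu> x \<in> {..<\<epsilon>}}"
      using \<nu>(2) by (rule openin_continuous_map_preimage) simp
    moreover have "0 \<in> {x \<in> topspace T. \<nu> x \<in> {..<\<epsilon>}}"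
      using \<epsilon> \<nu>_scale[of 0 0] by (simp add: topF)
    ultimately obtain Q \<delta> where "finite Q" "Q \<subseteq> range p" "0 < \<delta>"
      "{y\<in>F. \<forall>q\<in>Q. q (y - 0) < \<delta>} \<subseteq> {x \<in> topspace T. \<nu> x \<in> {..<\<epsilon>}}"
      unfolding T openin_seminorm_topology by blast
    then show ?thesis by (intro exI[of _ Q] exI[of _ \<delta>]) auto
  qed
  \<comment> \<open>Openness of the \<open>\<nu>\<close>-balls turns density for \<open>T\<close>
    into density for \<open>\<nu>\<close>. The room left around \<open>y\<close> is
    \<open>\<epsilon> - \<nu> (y - x)\<close>.\<close>
  have ball: "openin T {y \<in> F. \<nu> (y - x) < \<epsilon>}" if x: "x \<in> F" for x \<epsilon>
    unfolding T openin_seminorm_topology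
  proof (intro conjI ballI)
    fix y assume y: "y \<in> {y \<in> F. \<nu> (y - x) < \<epsilon>}"
    then obtain Q \<delta> where Q: "finite Q" "Q \<subseteq> range p" "0 < \<delta>"
      "\<And>z. z \<in> F \<Longrightarrow> (\<forall>q\<in>Q. q z < \<delta>) \<Longrightarrow> \<nu> z < \<epsilon> - \<nu> (y - x)"
      using nbhd[of "\<epsilon> - \<nu> (y - x)"] by auto
    have "\<nu> (z - x) < \<epsilon>" if "z \<in> F" "\<forall>q\<in>Q. q (z - y) < \<delta>" for z
      using \<nu>_add[of "z - y" "y - x"] Q(4)[of "z - y"] that x y by simp
    then show "\<exists>Q \<delta>. finite Q \<and> Q \<subseteq> range p \<and> 0 < \<delta> \<and>
        {z\<in>F. \<forall>q\<in>Q. q (z - y) < \<delta>} \<subseteq> {y \<in> F. \<nu> (y - x) < \<epsilon>}"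
      using Q by (intro exI[of _ Q] exI[of _ \<delta>]) auto
  qed auto
  obtain D where D: "countable D" "D \<subseteq> F" "T closure_of D = F"
    using assms(2) unfolding separable_space_def topF by blast
  \<comment> \<open>\<open>F\<close> contains 0, so the dense set is nonempty and can be enumerated
    by all natural numbers, with repetitions.\<close>
  have "D \<noteq> {}" using D(3) V_zero by auto
  then obtain X :: "nat \<Rightarrow> 'a" where X: "range X = D"
    using range_from_nat_into[OF _ D(1)] by blast
  have XF: "X k \<in> F" for k using X D(2) by auto
  have dense: "\<exists>k. \<nu> (X k - x) < \<epsilon>" if x: "x \<in> F" and \<epsilon>: "0 < \<epsilon>" for x \<epsilon>
  proof -
    have "\<nu> 0 = 0" using \<nu>_scale[of 0 0] by simp
    then have "x \<in> {y \<in> F. \<nu> (y - x) < \<epsilon>} \<and> openin T {y \<in> F. \<nu> (y - x) < \<epsilon>}"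
      using x \<epsilon> ball[OF x] by simp
    moreover have "x \<in> T closure_of D" using D(3) x by simp
    ultimately obtain y where "y \<in> D" "y \<in> {y \<in> F. \<nu> (y - x) < \<epsilon>}"
      unfolding in_closure_of by metis
    then show ?thesis using X by auto
  qed
  obtain \<Phi> where "(\<forall>x\<in>F. \<forall>y\<in>F. \<Phi> (x + y) = \<Phi> x + \<Phi> y) \<and>
    (\<forall>c. \<forall>x\<in>F. \<Phi> (s c x) = fun_scale c (\<Phi> x)) \<and>
    inj_on \<Phi> F \<and> \<Phi> ` F \<subseteq> hol_space G \<and>
    (\<forall>x\<in>F. \<forall>z. cmod (\<Phi> x z) \<le> \<nu> x * exp (cmod z)) \<and>
    polynomials_on G \<subseteq> \<Phi> ` F \<and> (\<forall>k. \<Phi> (X k) \<in> polynomials_on G)"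
    using ex_holomorphic_embedding[of X G, OF assms(3) XF dense assms(5,7)] ..
  then have add: "\<And>x y. x \<in> F \<Longrightarrow> y \<in> F \<Longrightarrow> \<Phi> (x + y) = \<Phi> x + \<Phi> y"
    and scale: "\<And>c x. x \<in> F \<Longrightarrow> \<Phi> (s c x) = fun_scale c (\<Phi> x)"
    and inj: "inj_on \<Phi> F" and hol: "\<Phi> ` F \<subseteq> hol_space G"
    and bound: "\<And>x z. x \<in> F \<Longrightarrow> cmod (\<Phi> x z) \<le> \<nu> x * exp (cmod z)"
    and poly: "polynomials_on G \<subseteq> \<Phi> ` F" and X_poly: "\<And>k. \<Phi> (X k) \<in> polynomials_on G"
    by simp_all
  define E where "E = \<Phi> ` F"
  interpret fs: vector_space fun_scale by (rule vector_space_fun_scale)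
  have \<Phi>0: "\<Phi> 0 = 0" using add[of 0 0] by simp
  have sub: "fs.subspace E"
    unfolding fs.subspace_def E_def
    using \<Phi>0 add[symmetric] scale[symmetric] by (auto intro: image_eqI[of _ _ 0])
  have bij: "bij_betw \<Phi> F E" using inj by (simp add: E_def bij_betw_def)
  obtain T' where fr: "frechet_space fun_scale E T'" and hom: "homeomorphic_map T T' \<Phi>"
    using frechet_space_transport[OF assms(1) vector_space_fun_scale sub bij add scale] by blast
  have \<Phi>_diff: "\<Phi> (x - y) = \<Phi> x - \<Phi> y" if "x \<in> F" "y \<in> F" for x y
    using add[of "x - y" y] that by simp
  have cont: "continuous_map T (hol_topology G) \<Phi>"
    unfolding T hol_topology_def
  proof (rule continuous_map_seminorm_topology)
    fix q :: "(complex \<Rightarrow> complex) \<Rightarrow> real" and \<epsilon> :: real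
    assume "q \<in> {(\<lambda>f. SUP z\<in>K. cmod (f z)) | K. compact K \<and> K \<noteq> {} \<and> K \<subseteq> G}" and \<epsilon>: "0 < \<epsilon>"
    then obtain K where K: "compact K" "K \<noteq> {}" and q: "q = (\<lambda>f. SUP z\<in>K. cmod (f z))" by blast
    obtain R where R: "\<And>z. z \<in> K \<Longrightarrow> cmod z \<le> R"
      using compact_imp_bounded[OF K(1)] unfolding bounded_iff by blast
    \<comment> \<open>\<open>K\<close> lies in the disc of radius \<open>R\<close>, so the
      exponential bound makes this seminorm of \<open>\<Phi> x\<close> at most a fixed multiple of
      \<open>\<nu> x\<close>.\<close>
    have qb: "q (\<Phi> x) \<le> \<nu> x * exp R" if x: "x \<in> F" for x
      unfolding q
    proof (rule cSUP_least[OF K(2)])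
      fix z assume "z \<in> K"
      then have "\<nu> x * exp (cmod z) \<le> \<nu> x * exp R"
        using R \<nu>_nonneg[OF x] by (intro mult_left_mono) auto
      then show "cmod (\<Phi> x z) \<le> \<nu> x * exp R" using bound[OF x, of z] by simp
    qed
    obtain Q \<delta> where Q: "finite Q" "Q \<subseteq> range p" "0 < \<delta>"
      "\<And>x. x \<in> F \<Longrightarrow> (\<forall>q\<in>Q. q x < \<delta>) \<Longrightarrow> \<nu> x < \<epsilon> / exp R"
      using nbhd[of "\<epsilon> / exp R"] \<epsilon> by auto
    have "q (\<Phi> x) < \<epsilon>" if "x \<in> F" "\<forall>q\<in>Q. q x < \<delta>" for x
      using qb[OF that(1)] Q(4)[OF that] by (simp add: pos_less_divide_eq)
    then show "\<exists>Q \<delta>. finite Q \<and> Q \<subseteq> range p \<and> 0 < \<delta> \<and> (\<forall>x\<in>F. (\<forall>p\<in>Q. p x < \<delta>) \<longrightarrow> q (\<Phi> x) < \<epsilon>)"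
      using Q by blast
  qed (use hol \<Phi>_diff in auto)
  obtain \<Psi> where \<Psi>: "homeomorphic_maps T T' \<Phi> \<Psi>"
    using hom unfolding homeomorphic_map_maps by blast
  have topE: "topspace T' = E"
    using homeomorphic_imp_surjective_map[OF hom] by (simp add: topF E_def)
  \<comment> \<open>On \<open>E\<close> the inclusion is \<open>\<Phi> \<circ> \<Psi>\<close>, so
    its continuity comes from that of \<open>\<Phi>\<close> into the larger space.\<close>
  have "continuous_map T' (hol_topology G) (\<Phi> \<circ> \<Psi>)"
    using \<Psi> cont by (auto simp: homeomorphic_maps_def intro: continuous_map_compose)
  then have incl: "continuous_map T' (hol_topology G) (\<lambda>f. f)"
    using \<Psi> by (elim continuous_map_eq) (auto simp: homeomorphic_maps_def)
  have closure: "T' closure_of polynomials_on G = E"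
  proof -
    \<comment> \<open>The closure is computed in \<open>F\<close>: the preimage of the polynomials
      contains the dense set \<open>D\<close>, and a homeomorphism carries closures to
      closures.\<close>
    define S where "S = {x \<in> F. \<Phi> x \<in> polynomials_on G}"
    have "\<Phi> ` S = polynomials_on G" using poly by (auto simp: S_def)
    moreover have "T closure_of S = F"
    proof
      show "T closure_of S \<subseteq> F" using closure_of_subset_topspace[of T S] topF by simp
      have "D \<subseteq> S" using X XF X_poly by (auto simp: S_def)
      then show "F \<subseteq> T closure_of S" using closure_of_mono[of D S T] D(3) by simp
    qed
    ultimately show ?thesis
      using homeomorphic_map_closure_of[OF hom, of S] by (auto simp: topF S_def E_def)
  qed
  have "frechet_space_of_holomorphic_functions G E T'"
    using fr hol incl poly by (simp add: frechet_space_of_holomorphic_functions_def E_def)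
  moreover have "isomorphic_tvs s F T fun_scale E T'"
    unfolding isomorphic_tvs_def using bij add scale hom by blast
  ultimately show ?thesis using closure by blast
qed

end
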